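(* Let $\rho_{\mathrm F}\in[0,1]$ be a given bandwidth fraction and consider, for a given rate-profile factor $\alpha_{\mathrm F}\in[0,1]$, the optimization problem $$\max_{q_1,R}\ R\quad\text{s.t.}\quad q_1\in[x_1,x_2],\ R\ge0,\ r_1^{\rho_{\mathrm F}}(q_1)\ge\alpha_{\mathrm F} R,\ r_2^{\rho_{\mathrm F}}(q_1)\ge(1-\alpha_{\mathrm F})R,$$ where $$r_1^{\rho_{\mathrm F}}(x)=\rho_{\mathrm F}\log_2\!\left(1+\frac{\eta P_1/(\rho_{\mathrm F}\sigma^2)}{d_1^2+(x-x_1)^2}\right),\qquad r_2^{\rho_{\mathrm F}}(x)=(1-\rho_{\mathrm F})\log_2\!\left(1+\frac{\eta P_2/((1-\rho_{\mathrm F})\sigma^2)}{d_2^2+(x-x_2)^2}\right).$$ Given $\alpha_{\mathrm F}$, the optimal activated antenna position $q_1$ that solves this problem is given by $$q_{\alpha_{\mathrm F}}^{\rho_{\mathrm F}}=\begin{cases}x_1 & \text{if } \frac1{1-\alpha_{\mathrm F}}r_2^{\rho_{\mathrm F}}(x_1)>\frac1{\alpha_{\mathrm F}} r_1^{\rho_{\mathrm F}}(x_1),\\ x_2 & \text{if } \frac1{\alpha_{\mathrm F}} r_1^{\rho_{\mathrm F}}(x_2)>\frac1{1-\alpha_{\mathrm F}}r_2^{\rho_{\mathrm F}}(x_2),\\ x_{\alpha_{\mathrm F}}^{\rho_{\mathrm F}} & \text{otherwise,}\end{cases}$$ where $x_{\alpha_{\mathrm F}}^{\rho_{\mathrm F}}$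 is the solution of $x$ to the equation $\frac1{1-\alpha_{\mathrm F}}r_2^{\rho_{\mathrm F}}(x)=\frac1{\alpha_{\mathrm F}} r_1^{\rho_{\mathrm F}}(x)$ with $x\in[x_1,x_2]$.
   Context: A base station serves two single-antenna uplink users through one dielectric waveguide, parallel to the $x$-axis at height $d$ and with $y$-coordinate $y_{\mathrm p}$, on which a single antenna is activated at the point $[q_1,y_{\mathrm p},d]^{\mathsf T}$. User $k\in\{1,2\}$ is located at $[x_k,y_k,0]^{\mathsf T}$, with $x_1\le x_2$, and $d_k^2=d^2+(y_k-y_{\mathrm p})^2$. $P_k$ is the maximum transmit power of user $k$, $\sigma^2$ is the noise power, and $\eta=\frac{c^2}{16\pi^2 f_{\mathrm c}^2}$ with $c$ the speed of light and $f_{\mathrm c}$ the carrier frequency. Under a free-space line-of-sight model the channel power gain of user $k$ is $\eta/(d_k^2+(x_k-q_1)^2)$. Under frequency-division multiple access the users transmit simultaneously over orthogonal frequency bands, $\rho_{\mathrm F}$ being the fraction of bandwidth allocated to user 1, and $r_k^{\rho_{\mathrm F}}(x)$ is the resulting rate of user $k$ when the antenna is activated at coordinate $x$. The factor $\alpha_{\mathrm F}$ specifies the share of user 1 in the sum-rate $R$. *)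

theory Defs
  imports Complex_Main "HOL-Library.Extended_Real"
begin

definition free_space_gain :: "real \<Rightarrow> real \<Rightarrow> real" where
  "free_space_gain c fc = c\<^sup>2 / (16 * pi\<^sup>2 * fc\<^sup>2)"

text \<open>
  The rate, with the antenna activated at \<open>x\<close>, of a user at \<open>xk\<close> who transmits with power \<open>P\<close> over
  a fraction \<open>\<beta>\<close> of the band: the noise power in that fraction is \<open>\<beta> * \<sigma>\<^sup>2\<close>. At \<open>\<beta> = 0\<close> the
  formula is read as its limit \<open>0\<close>, which is also its value under \<open>z / 0 = 0\<close>.
\<close>

definition fdma_rate ::
  "real \<Rightarrow> real \<Rightarrow> real \<Rightarrow> real \<Rightarrow> real \<Rightarrow> real \<Rightarrow> real \<Rightarrow> real" where
  "fdma_rate \<eta> \<sigma> \<beta> P dk xk x =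
     \<beta> * log 2 (1 + (\<eta> * P / (\<beta> * \<sigma>\<^sup>2)) / (dk\<^sup>2 + (x - xk)\<^sup>2))"

definition rate_profile_feasible ::
  "(real \<Rightarrow> real) \<Rightarrow> (real \<Rightarrow> real) \<Rightarrow> real \<Rightarrow> real \<Rightarrow> real \<Rightarrow> real \<Rightarrow> real \<Rightarrow> bool" where
  "rate_profile_feasible r1 r2 x1 x2 \<alpha> q R \<longleftrightarrow>
     q \<in> {x1..x2} \<and> R \<ge> 0 \<and> r1 q \<ge> \<alpha> * R \<and> r2 q \<ge> (1 - \<alpha>) * R"

definition rate_profile_solution ::
  "(real \<Rightarrow> real) \<Rightarrow> (real \<Rightarrow> real) \<Rightarrow> real \<Rightarrow> real \<Rightarrow> real \<Rightarrow> real \<Rightarrow> real \<Rightarrow> bool" where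
  "rate_profile_solution r1 r2 x1 x2 \<alpha> q R \<longleftrightarrow>
     rate_profile_feasible r1 r2 x1 x2 \<alpha> q R \<and>
     (\<forall>q' R'. rate_profile_feasible r1 r2 x1 x2 \<alpha> q' R' \<longrightarrow> R' \<le> R)"

definition optimal_position ::
  "(real \<Rightarrow> real) \<Rightarrow> (real \<Rightarrow> real) \<Rightarrow> real \<Rightarrow> real \<Rightarrow> real \<Rightarrow> real \<Rightarrow> bool" where
  "optimal_position r1 r2 x1 x2 \<alpha> q \<longleftrightarrow> (\<exists>R. rate_profile_solution r1 r2 x1 x2 \<alpha> q R)"

text \<open>
  The term \<open>(1/a) r\<close> is the upper bound on \<open>R\<close> imposed by the constraint \<open>r \<ge> a R\<close>. For \<open>a = 0\<close>
  there is no bound, whence the value \<open>\<infinity>\<close> (even if \<open>r = 0\<close>); the convention \<open>1 / 0 = 0\<close> would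
  select the wrong endpoint.
\<close>

definition scaled_rate :: "real \<Rightarrow> real \<Rightarrow> ereal" where
  "scaled_rate a r = (if a = 0 then \<infinity> else ereal (1 / a * r))"

definition is_balanced_position ::
  "(real \<Rightarrow> real) \<Rightarrow> (real \<Rightarrow> real) \<Rightarrow> real \<Rightarrow> real \<Rightarrow> real \<Rightarrow> real \<Rightarrow> bool" where
  "is_balanced_position r1 r2 x1 x2 \<alpha> x \<longleftrightarrow>
     x \<in> {x1..x2} \<and> scaled_rate (1 - \<alpha>) (r2 x) = scaled_rate \<alpha> (r1 x)"

definition position_formula ::
  "(real \<Rightarrow> real) \<Rightarrow> (real \<Rightarrow> real) \<Rightarrow> real \<Rightarrow> real \<Rightarrow> real \<Rightarrow> real" where
  "position_formula r1 r2 x1 x2 \<alpha> =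
     (if scaled_rate (1 - \<alpha>) (r2 x1) > scaled_rate \<alpha> (r1 x1) then x1
      else if scaled_rate \<alpha> (r1 x2) > scaled_rate (1 - \<alpha>) (r2 x2) then x2
      else (THE x. is_balanced_position r1 r2 x1 x2 \<alpha> x))"

end

theory Submission
  imports Defs
begin

text \<open>
  The largest \<open>R\<close> feasible at \<open>q\<close> is the minimum of the scaled rates \<open>F1 q\<close> and \<open>F2 q\<close>, where \<open>F1\<close>
  decreases and \<open>F2\<close> increases on \<open>[x1, x2]\<close>. If \<open>F1 < F2\<close> at \<open>x1\<close>, the minimum is \<open>F1\<close> there, which
  is the maximum of \<open>F1\<close>; symmetrically at \<open>x2\<close>. Otherwise the intermediate value theorem yields a
  crossing point, and moving away from it in either direction lowers one of the two rates.
\<close>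

lemma fdma_rate_zero_band [simp]: "fdma_rate \<eta> \<sigma> 0 P dk xk x = 0"
  by (simp add: fdma_rate_def)

lemma fdma_rate_pos:
  assumes "\<eta> > 0" "P > 0" "\<sigma> > 0" "dk\<^sup>2 > 0" "\<beta> > 0"
  shows "fdma_rate \<eta> \<sigma> \<beta> P dk xk x > 0"
proof -
  have "dk\<^sup>2 + (x - xk)\<^sup>2 > 0" using assms by (simp add: add_pos_nonneg)
  then have "(\<eta> * P / (\<beta> * \<sigma>\<^sup>2)) / (dk\<^sup>2 + (x - xk)\<^sup>2) > 0" using assms by simp
  then show ?thesis using assms by (simp add: fdma_rate_def)
qed

lemma fdma_rate_strict_antimono_dist:
  assumes "\<eta> > 0" "P > 0" "\<sigma> > 0" "dk\<^sup>2 > 0" "\<beta> > 0" "\<bar>x - xk\<bar> < \<bar>x' - xk\<bar>"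
  shows "fdma_rate \<eta> \<sigma> \<beta> P dk xk x' < fdma_rate \<eta> \<sigma> \<beta> P dk xk x"
proof -
  let ?A = "\<eta> * P / (\<beta> * \<sigma>\<^sup>2)"
  have A: "?A > 0" using assms by simp
  have sq: "(x - xk)\<^sup>2 < (x' - xk)\<^sup>2" using assms(6) by (meson abs_le_square_iff not_le)
  have pos: "dk\<^sup>2 + (x - xk)\<^sup>2 > 0" using assms by (simp add: add_pos_nonneg)
  have "?A / (dk\<^sup>2 + (x' - xk)\<^sup>2) < ?A / (dk\<^sup>2 + (x - xk)\<^sup>2)"
    using A sq pos by (intro divide_strict_left_mono mult_pos_pos) auto
  moreover have "?A / (dk\<^sup>2 + (x' - xk)\<^sup>2) > 0"
    using A sq pos by (intro divide_pos_pos[OF A]) auto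
  ultimately show ?thesis using assms by (simp add: fdma_rate_def)
qed

lemma continuous_on_fdma_rate:
  assumes "\<eta> > 0" "P > 0" "\<sigma> > 0" "dk\<^sup>2 > 0" "\<beta> > 0"
  shows "continuous_on S (fdma_rate \<eta> \<sigma> \<beta> P dk xk)"
proof -
  have d: "dk\<^sup>2 + (x - xk)\<^sup>2 > 0" for x using assms by (simp add: add_pos_nonneg)
  then have "(\<eta> * P / (\<beta> * \<sigma>\<^sup>2)) / (dk\<^sup>2 + (x - xk)\<^sup>2) > 0" for x using assms by simp
  then have "1 + (\<eta> * P / (\<beta> * \<sigma>\<^sup>2)) / (dk\<^sup>2 + (x - xk)\<^sup>2) \<noteq> 0" for x
    by (smt (verit))
  with assms(4) show ?thesis
    unfolding fdma_rate_def log_def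
    by (intro continuous_intros) (auto simp: sum_power2_eq_zero_iff)
qed

text \<open>For \<open>a = 0\<close> the left side is trivially true, and the right side becomes
  \<open>0 \<le> r\<close>; this is where nonnegativity of \<open>r\<close> enters.\<close>

lemma le_scaled_rate_iff:
  assumes "a \<ge> 0" "r \<ge> 0"
  shows "ereal R \<le> scaled_rate a r \<longleftrightarrow> a * R \<le> r"
  using assms by (auto simp: scaled_rate_def field_simps)

lemma scaled_rate_mono: "a \<ge> 0 \<Longrightarrow> r \<le> s \<Longrightarrow> scaled_rate a r \<le> scaled_rate a s"
  by (auto simp: scaled_rate_def divide_right_mono)

lemma scaled_rate_strict_mono: "a > 0 \<Longrightarrow> r < s \<Longrightarrow> scaled_rate a r < scaled_rate a s"
  by (auto simp: scaled_rate_def divide_strict_right_mono)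

text \<open>Eliminates \<open>R\<close>: at a fixed \<open>q\<close> the feasible values are exactly
  those in \<open>[0, m q]\<close>, so optimality of \<open>q\<close> means that \<open>q\<close>
  maximizes \<open>m\<close>.\<close>

lemma optimal_position_iff:
  assumes "\<alpha> \<in> {0..1}" and nonneg: "\<And>x. r1 x \<ge> 0" "\<And>x. r2 x \<ge> 0"
  defines "m \<equiv> \<lambda>x. min (scaled_rate \<alpha> (r1 x)) (scaled_rate (1 - \<alpha>) (r2 x))"
  shows "optimal_position r1 r2 x1 x2 \<alpha> q \<longleftrightarrow> q \<in> {x1..x2} \<and> (\<forall>q'\<in>{x1..x2}. m q' \<le> m q)"
proof -
  have feas: "rate_profile_feasible r1 r2 x1 x2 \<alpha> q R \<longleftrightarrow> q \<in> {x1..x2} \<and> R \<ge> 0 \<and> ereal R \<le> m q"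
    for q R
    using assms by (auto simp: rate_profile_feasible_def m_def le_scaled_rate_iff)
  \<comment> \<open>At most one of \<open>\<alpha>\<close> and \<open>1 - \<alpha>\<close> vanishes,
    so the minimum is finite. Its real value \<open>v q\<close> is itself feasible and serves as the
    witness for \<open>R\<close>.\<close>
  have "\<exists>v. v \<ge> 0 \<and> m q = ereal v" for q
    using assms by (auto simp: m_def scaled_rate_def min_def)
  then obtain v where v: "\<And>q. v q \<ge> 0" "\<And>q. m q = ereal (v q)" by metis
  show ?thesis
    unfolding optimal_position_def rate_profile_solution_def feas v ereal_less_eq
    using v(1) by (meson order.trans order.refl)
qed

text \<open>The second conjunct makes the \<open>THE\<close> in the formula meaningful. The
  condition in the third excludes a user with a positive share but no bandwidth: then
  \<open>R = 0\<close> is forced and every point of \<open>[x1, x2]\<close> is optimal.\<close>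

theorem theorem2:
  fixes x1 x2 y1 y2 yp d d1 d2 P1 P2 \<sigma> c fc \<eta> \<rho> \<alpha> :: real
    and r1 r2 :: "real \<Rightarrow> real"
  assumes "x1 \<le> x2" and "d > 0"
    and "d1\<^sup>2 = d\<^sup>2 + (y1 - yp)\<^sup>2" and "d2\<^sup>2 = d\<^sup>2 + (y2 - yp)\<^sup>2"
    and "P1 > 0" and "P2 > 0" and "\<sigma> > 0" and "c > 0" and "fc > 0"
    and "\<eta> = free_space_gain c fc"
    and "\<rho> \<in> {0..1}" and "\<alpha> \<in> {0..1}"
    and "r1 = fdma_rate \<eta> \<sigma> \<rho> P1 d1 x1"
    and "r2 = fdma_rate \<eta> \<sigma> (1 - \<rho>) P2 d2 x2"
  shows "optimal_position r1 r2 x1 x2 \<alpha> (position_formula r1 r2 x1 x2 \<alpha>) \<and>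
    (\<not> scaled_rate (1 - \<alpha>) (r2 x1) > scaled_rate \<alpha> (r1 x1) \<and>
     \<not> scaled_rate \<alpha> (r1 x2) > scaled_rate (1 - \<alpha>) (r2 x2) \<longrightarrow>
       (\<exists>!x. is_balanced_position r1 r2 x1 x2 \<alpha> x)) \<and>
    ((\<alpha> > 0 \<longrightarrow> \<rho> > 0) \<and> (\<alpha> < 1 \<longrightarrow> \<rho> < 1) \<longrightarrow>
       (\<forall>q. optimal_position r1 r2 x1 x2 \<alpha> q \<longrightarrow> q = position_formula r1 r2 x1 x2 \<alpha>))"
proof -
  define F1 where "F1 = (\<lambda>x. scaled_rate \<alpha> (r1 x))"
  define F2 where "F2 = (\<lambda>x. scaled_rate (1 - \<alpha>) (r2 x))"
  have \<eta>: "\<eta> > 0" using assms by (simp add: free_space_gain_def)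
  have d1: "d1\<^sup>2 > 0" and d2: "d2\<^sup>2 > 0" using assms by (simp_all add: add_pos_nonneg)
  have \<alpha>: "0 \<le> \<alpha>" "\<alpha> \<le> 1" and \<rho>: "0 \<le> \<rho>" "\<rho> \<le> 1" using assms by auto
  have r1_zero: "r1 x = 0" if "\<rho> = 0" for x using that assms by simp
  have r2_zero: "r2 x = 0" if "\<rho> = 1" for x using that assms by simp
  have r1_pos: "r1 x > 0" if "\<rho> > 0" for x
    using that assms \<eta> d1 by (simp add: fdma_rate_pos)
  have r2_pos: "r2 x > 0" if "\<rho> < 1" for x
    using that assms \<eta> d2 by (simp add: fdma_rate_pos)
  have r1_nonneg: "r1 x \<ge> 0" for x using r1_zero r1_pos \<rho> by (metis order.order_iff_strict)
  have r2_nonneg: "r2 x \<ge> 0" for x using r2_zero r2_pos \<rho> by (metis order.order_iff_strict)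
  have r1_less: "r1 y < r1 x" if "\<rho> > 0" "x1 \<le> x" "x < y" for x y
    using that assms(5,7) \<eta> d1 unfolding assms(13)
    by (intro fdma_rate_strict_antimono_dist) auto
  have r2_less: "r2 x < r2 y" if "\<rho> < 1" "x < y" "y \<le> x2" for x y
    using that assms(6,7) \<eta> d2 unfolding assms(14)
    by (intro fdma_rate_strict_antimono_dist) auto
  have F1_less: "F1 y < F1 x" if "\<alpha> > 0" "\<rho> > 0" "x1 \<le> x" "x < y" for x y
    using that r1_less scaled_rate_strict_mono by (simp add: F1_def)
  have F2_less: "F2 x < F2 y" if "\<alpha> < 1" "\<rho> < 1" "x < y" "y \<le> x2" for x y
    using that r2_less scaled_rate_strict_mono by (simp add: F2_def)
  \<comment> \<open>Only weak monotonicity survives in the degenerate cases: \<open>r1\<close> is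
    constantly 0 if \<open>\<rho> = 0\<close>, and \<open>F1\<close> is constantly
    \<open>\<infinity>\<close> if \<open>\<alpha> = 0\<close>.\<close>
  have F1_le: "F1 y \<le> F1 x" if "x1 \<le> x" "x \<le> y" for x y
    unfolding F1_def using r1_less[of x y] r1_zero \<rho> \<alpha> that
    by (intro scaled_rate_mono) (auto simp: order.order_iff_strict)
  have F2_le: "F2 x \<le> F2 y" if "x \<le> y" "y \<le> x2" for x y
    unfolding F2_def using r2_less[of x y] r2_zero \<rho> \<alpha> that
    by (intro scaled_rate_mono) (auto simp: order.order_iff_strict)
  have F1_top: "F1 x = \<infinity>" if "\<alpha> = 0" for x using that by (simp add: F1_def scaled_rate_def)
  have F2_top: "F2 x = \<infinity>" if "\<alpha> = 1" for x using that by (simp add: F2_def scaled_rate_def)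
  have opt: "optimal_position r1 r2 x1 x2 \<alpha> q \<longleftrightarrow>
      q \<in> {x1..x2} \<and> (\<forall>q'\<in>{x1..x2}. min (F1 q') (F2 q') \<le> min (F1 q) (F2 q))" for q
    unfolding F1_def F2_def using assms(12) r1_nonneg r2_nonneg by (rule optimal_position_iff)
  have bal: "is_balanced_position r1 r2 x1 x2 \<alpha> x \<longleftrightarrow> x \<in> {x1..x2} \<and> F2 x = F1 x" for x
    by (simp add: is_balanced_position_def F1_def F2_def)
  have formula: "position_formula r1 r2 x1 x2 \<alpha> =
      (if F2 x1 > F1 x1 then x1 else if F1 x2 > F2 x2 then x2
       else (THE x. is_balanced_position r1 r2 x1 x2 \<alpha> x))"
    by (simp add: position_formula_def F1_def F2_def)

  \<comment> \<open>Each boundary value triggers an endpoint case. \<open>\<alpha> = 0\<close> gives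
    \<open>F1 x2 = \<infinity>\<close> with \<open>F2 x2\<close> finite, and
    \<open>\<rho> = 0\<close> gives \<open>F1 x1 = 0 < F2 x1\<close>; \<open>\<alpha> = 1\<close>
    and \<open>\<rho> = 1\<close> are symmetric.\<close>
  have interior: "0 < \<alpha> \<and> \<alpha> < 1 \<and> 0 < \<rho> \<and> \<rho> < 1"
    if no1: "\<not> F2 x1 > F1 x1" and no2: "\<not> F1 x2 > F2 x2"
  proof -
    have a: "0 < \<alpha>" using no2 \<alpha> F1_top
      by (cases "\<alpha> = 0") (auto simp: F2_def scaled_rate_def)
    have b: "\<alpha> < 1" using no1 \<alpha> F2_top
      by (cases "\<alpha> = 1") (auto simp: F1_def scaled_rate_def)
    have c: "0 < \<rho>" using no1 a b \<rho> r1_zero[of x1] r2_pos[of x1]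
      by (cases "\<rho> = 0") (auto simp: F1_def F2_def scaled_rate_def)
    have d: "\<rho> < 1" using no2 a b \<rho> r2_zero[of x2] r1_pos[of x2]
      by (cases "\<rho> = 1") (auto simp: F1_def F2_def scaled_rate_def)
    from a b c d show ?thesis by blast
  qed
  have ex1: "\<exists>!x. is_balanced_position r1 r2 x1 x2 \<alpha> x"
    if no1: "\<not> F2 x1 > F1 x1" and no2: "\<not> F1 x2 > F2 x2"
  proof -
    from interior[OF that] have a: "0 < \<alpha>" "\<alpha> < 1" "0 < \<rho>" "\<rho> < 1" by auto
    \<comment> \<open>Both weights are positive here, so \<open>F1\<close> and \<open>F2\<close> are
      finite and the intermediate value theorem applies to their real difference, which is
      \<open>\<le> 0\<close> at \<open>x1\<close> and \<open>\<ge> 0\<close> at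
      \<open>x2\<close>.\<close>
    let ?h = "\<lambda>x. 1 / (1 - \<alpha>) * r2 x - 1 / \<alpha> * r1 x"
    have h: "F2 x \<le> F1 x \<longleftrightarrow> ?h x \<le> 0" "F1 x \<le> F2 x \<longleftrightarrow> 0 \<le> ?h x" for x
      using a by (auto simp: F1_def F2_def scaled_rate_def)
    have "continuous_on {x1..x2} ?h"
      using a assms \<eta> d1 d2 by (intro continuous_intros) (simp_all add: continuous_on_fdma_rate)
    then obtain x where x: "x1 \<le> x" "x \<le> x2" "?h x = 0"
      using IVT'[of ?h x1 0 x2] no1 no2 h assms(1) by (auto simp: not_less)
    then have x': "F2 x = F1 x" using h[of x] by (simp add: order.antisym)
    \<comment> \<open>Two crossings \<open>y < z\<close> would give
      \<open>F1 z < F1 y = F2 y < F2 z = F1 z\<close>.\<close>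
    have False if "y \<in> {x1..x2}" "z \<in> {x1..x2}" "F2 y = F1 y" "F2 z = F1 z" "y < z" for y z
      using F1_less[of y z] F2_less[of y z] a that by auto
    then show ?thesis unfolding bal using x x' by (metis atLeastAtMost_iff linorder_neqE)
  qed

  consider (first) "F2 x1 > F1 x1" | (second) "\<not> F2 x1 > F1 x1" "F1 x2 > F2 x2"
    | (third) "\<not> F2 x1 > F1 x1" "\<not> F1 x2 > F2 x2" by blast
  then have main: "optimal_position r1 r2 x1 x2 \<alpha> (position_formula r1 r2 x1 x2 \<alpha>) \<and>
    ((\<alpha> > 0 \<longrightarrow> \<rho> > 0) \<and> (\<alpha> < 1 \<longrightarrow> \<rho> < 1) \<longrightarrow>
       (\<forall>q. optimal_position r1 r2 x1 x2 \<alpha> q \<longrightarrow> q = position_formula r1 r2 x1 x2 \<alpha>))"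
  proof cases
    case first
    then have p: "position_formula r1 r2 x1 x2 \<alpha> = x1" by (simp add: formula)
    have m: "min (F1 x1) (F2 x1) = F1 x1" using first by (simp add: min_absorb1)
    have o: "optimal_position r1 r2 x1 x2 \<alpha> x1"
      unfolding opt m using assms(1) F1_le[of x1] by (auto intro: min.coboundedI1)
    \<comment> \<open>\<open>F1 x1\<close> lies below \<open>F2 x1\<close>, hence is not
      \<open>\<infinity>\<close>. With \<open>\<alpha> > 0\<close> the uniqueness condition supplies
      \<open>\<rho> > 0\<close>, so any \<open>q > x1\<close> has a minimum of at most
      \<open>F1 q < F1 x1\<close>.\<close>
    have "\<alpha> > 0" using first F1_top[of x1] \<alpha> by (cases "\<alpha> = 0") auto
    then have "q = x1" if "\<rho> > 0" "optimal_position r1 r2 x1 x2 \<alpha> q" for q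
      using that F1_less[of x1 q] assms(1) m unfolding opt
      by (metis atLeastAtMost_iff linorder_not_le min.bounded_iff order.order_iff_strict order.refl)
    with o p \<open>\<alpha> > 0\<close> show ?thesis by auto
  next
    case second
    then have p: "position_formula r1 r2 x1 x2 \<alpha> = x2" by (simp add: formula)
    have m: "min (F1 x2) (F2 x2) = F2 x2" using second by (simp add: min_absorb2)
    have o: "optimal_position r1 r2 x1 x2 \<alpha> x2"
      unfolding opt m using assms(1) F2_le[of _ x2] by (auto intro: min.coboundedI2)
    have "\<alpha> < 1" using second F2_top[of x2] \<alpha> by (cases "\<alpha> = 1") auto
    then have "q = x2" if "\<rho> < 1" "optimal_position r1 r2 x1 x2 \<alpha> q" for q
      using that F2_less[of q x2] assms(1) m unfolding opt
      by (metis atLeastAtMost_iff linorder_not_le min.bounded_iff order.order_iff_strict order.refl)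
    with o p \<open>\<alpha> < 1\<close> show ?thesis by auto
  next
    case third
    note a = interior[OF third]
    define p where "p = position_formula r1 r2 x1 x2 \<alpha>"
    have "is_balanced_position r1 r2 x1 x2 \<alpha> p"
      unfolding p_def formula using third theI'[OF ex1[OF third]] by simp
    then have p: "p \<in> {x1..x2}" "F2 p = F1 p" unfolding bal by auto
    \<comment> \<open>To the left of \<open>p\<close> the rate \<open>F2\<close> drops below the
      common value, to the right \<open>F1\<close> does. Both monotonicities are strict by
      \<open>interior\<close>, so uniqueness is unconditional in this case.\<close>
    have less: "min (F1 q) (F2 q) < F1 p" if "q \<in> {x1..x2}" "q \<noteq> p" for q
      using that p a F1_less[of p q] F2_less[of q p] by (cases "q < p") (auto simp: min_less_iff_disj)
    have m: "min (F1 p) (F2 p) = F1 p" using p by simp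
    have "optimal_position r1 r2 x1 x2 \<alpha> p"
      unfolding opt m using p less m by (metis order.order_iff_strict)
    moreover have "q = p" if "optimal_position r1 r2 x1 x2 \<alpha> q" for q
      using that less[of q] p m unfolding opt by (metis linorder_not_le)
    ultimately show ?thesis unfolding p_def by blast
  qed
  then show ?thesis using ex1 unfolding F1_def F2_def by blast
qed

end
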